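(* Let $-\infty<a<b<\infty$ and $m\ge1$. Suppose that $c_1,\ldots,c_m$ are the first $m$ terms (with indices $1,\dots,m$) of an admissible sequence for $[a,b]$, and let $L:\mathcal{P}_{[a,b]}\to\mathbb{R}$ be a functional that is affine on $\mathcal{F}_m(c_{1:m})$. If $L$ is also upper semicontinuous on $\mathcal{F}_m(c_{1:m})$ with respect to the weak topology, then $$\sup_{\mu\in\mathcal{F}_m(c_{1:m})}L(\mu)$$ is attained by a distribution in $\mathcal{F}_m(c_{1:m})$ supported on at most $m+1$ points in $[a,b]$; while if $L$ is lower semicontinuous on $\mathcal{F}_m(c_{1:m})$ with respect to the weak topology, then $$\inf_{\mu\in\mathcal{F}_m(c_{1:m})}L(\mu)$$ is attained by a distribution in $\mathcal{F}_m(c_{1:m})$ supported on at most $m+1$ points in $[a,b]$.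
   Context: $\mathcal{P}_{[a,b]}$ denotes the set of Borel probability measures on $[a,b]$, equipped with the weak topology. A real sequence $\{\varepsilon_n\}_{n\ge0}$ is admissible for $[a,b]$ if there is $\mu\in\mathcal{P}_{[a,b]}$ with $\varepsilon_n=\frac1{n!}\int_{[a,b]}(b-x)^n\,\mu(dx)$ for all $n\ge0$ (with $0^0=1$). For $c_{1:m}=(c_1,\dots,c_m)\in\mathbb{R}^m$, $$\mathcal{F}_m(c_{1:m}):=\left\{\mu\in\mathcal{P}_{[a,b]}:\frac1{j!}\int_{[a,b]}(b-t)^j\,\mu(dt)=c_j\text{ for }j=1,\ldots,m\right\}.$$ $L$ is affine on the convex set $\mathcal{F}_m(c_{1:m})$ if $L(\lambda\mu_1+(1-\lambda)\mu_2)=\lambda L(\mu_1)+(1-\lambda)L(\mu_2)$ for all $\mu_1,\mu_2\in\mathcal{F}_m(c_{1:m})$ and $\lambda\in[0,1]$. *)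

theory Defs
  imports "HOL-Probability.Probability"
begin

definition borel_probs :: "real \<Rightarrow> real \<Rightarrow> real measure set" where
  "borel_probs a b = {\<mu>. prob_space \<mu> \<and> sets \<mu> = sets (restrict_space borel {a..b})}"

text \<open>
  Every continuous function on the compact interval is bounded, so the test functions below are
  all the bounded continuous functions on it.
\<close>

definition weak_topology :: "real \<Rightarrow> real \<Rightarrow> real measure topology" where
  "weak_topology a b = topology_generated_by
     {{\<mu> \<in> borel_probs a b. (\<integral>x. f x \<partial>\<mu>) \<in> U} | (f :: real \<Rightarrow> real) U.
        continuous_on {a..b} f \<and> open U}"

lemma topspace_weak_topology [simp]: "topspace (weak_topology a b) = borel_probs a b"
proof -
  have "\<exists>(f :: real \<Rightarrow> real) U. borel_probs a b = {\<mu> \<in> borel_probs a b. (\<integral>x. f x \<partial>\<mu>) \<in> U}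
      \<and> continuous_on {a..b} f \<and> open U"
    by (rule exI[of _ "\<lambda>_. 0"], rule exI[of _ UNIV]) auto
  then show ?thesis
    unfolding weak_topology_def topology_generated_by_topspace by blast
qed

definition upper_semicontinuous_on :: "'a topology \<Rightarrow> 'a set \<Rightarrow> ('a \<Rightarrow> real) \<Rightarrow> bool" where
  "upper_semicontinuous_on X S f \<longleftrightarrow>
     (\<forall>r. openin (subtopology X S) {x \<in> topspace (subtopology X S). f x < r})"

definition lower_semicontinuous_on :: "'a topology \<Rightarrow> 'a set \<Rightarrow> ('a \<Rightarrow> real) \<Rightarrow> bool" where
  "lower_semicontinuous_on X S f \<longleftrightarrow>
     (\<forall>r. openin (subtopology X S) {x \<in> topspace (subtopology X S). f x > r})"

definition admissible :: "real \<Rightarrow> real \<Rightarrow> (nat \<Rightarrow> real) \<Rightarrow> bool" where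
  "admissible a b \<epsilon> \<longleftrightarrow>
     (\<exists>\<mu>\<in>borel_probs a b. \<forall>n. \<epsilon> n = 1 / fact n * (\<integral>x. (b - x) ^ n \<partial>\<mu>))"

text \<open>Only the values \<open>c 1, \<dots>, c m\<close> are relevant.\<close>

definition moment_set :: "real \<Rightarrow> real \<Rightarrow> nat \<Rightarrow> (nat \<Rightarrow> real) \<Rightarrow> real measure set" where
  "moment_set a b m c =
     {\<mu> \<in> borel_probs a b. \<forall>j\<in>{1..m}. 1 / fact j * (\<integral>t. (b - t) ^ j \<partial>\<mu>) = c j}"

text \<open>The measure \<open>p \<mu> + (1 - p) \<nu>\<close>, for \<open>\<mu>\<close> and \<open>\<nu>\<close> on the same \<open>\<sigma>\<close>-algebra.\<close>

definition mix_measure :: "real \<Rightarrow> 'a measure \<Rightarrow> 'a measure \<Rightarrow> 'a measure" where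
  "mix_measure p \<mu> \<nu> = measure_of (space \<mu>) (sets \<mu>)
     (\<lambda>A. ennreal p * emeasure \<mu> A + ennreal (1 - p) * emeasure \<nu> A)"

lemma space_mix_measure [simp]: "space (mix_measure p \<mu> \<nu>) = space \<mu>"
  and sets_mix_measure [simp]: "sets (mix_measure p \<mu> \<nu>) = sets \<mu>"
  by (simp_all add: mix_measure_def)

lemma emeasure_mix_measure:
  assumes "sets \<nu> = sets \<mu>" "A \<in> sets \<mu>"
  shows "emeasure (mix_measure p \<mu> \<nu>) A
    = ennreal p * emeasure \<mu> A + ennreal (1 - p) * emeasure \<nu> A"
proof (rule emeasure_measure_of[OF mix_measure_def])
  let ?f = "\<lambda>A. ennreal p * emeasure \<mu> A + ennreal (1 - p) * emeasure \<nu> A"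
  show "positive (sets (mix_measure p \<mu> \<nu>)) ?f"
    by (simp add: positive_def)
  show "countably_additive (sets (mix_measure p \<mu> \<nu>)) ?f"
    unfolding countably_additive_def
  proof (intro allI impI)
    fix B :: "nat \<Rightarrow> 'a set"
    assume B: "range B \<subseteq> sets (mix_measure p \<mu> \<nu>)" "disjoint_family B"
    have "(\<Sum>i. ?f (B i)) = ennreal p * (\<Sum>i. emeasure \<mu> (B i))
        + ennreal (1 - p) * (\<Sum>i. emeasure \<nu> (B i))"
      by (simp add: suminf_add[symmetric])
    also have "\<dots> = ?f (\<Union>i. B i)"
      using B assms(1) by (simp add: suminf_emeasure)
    finally show "(\<Sum>i. ?f (B i)) = ?f (\<Union>i. B i)" .
  qed
qed (use assms sets.space_closed in auto)

lemma mix_measure_in_borel_probs: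
  assumes "\<mu> \<in> borel_probs a b" "\<nu> \<in> borel_probs a b" "p \<in> {0..1}"
  shows "mix_measure p \<mu> \<nu> \<in> borel_probs a b"
proof -
  have s: "sets \<nu> = sets \<mu>" and sp: "space \<nu> = space \<mu>"
    using assms sets_eq_imp_space_eq[of \<nu> \<mu>] by (auto simp: borel_probs_def)
  have "emeasure \<mu> (space \<mu>) = 1" "emeasure \<nu> (space \<mu>) = 1"
    using assms sp prob_space.emeasure_space_1 by (fastforce simp: borel_probs_def)+
  then have "emeasure (mix_measure p \<mu> \<nu>) (space \<mu>) = 1"
    using assms(3) s by (simp add: emeasure_mix_measure ennreal_plus[symmetric] del: ennreal_plus)
  then show ?thesis
    using assms(1) by (auto simp: borel_probs_def intro!: prob_spaceI)
qed

definition affine_functional_on :: "'a measure set \<Rightarrow> ('a measure \<Rightarrow> real) \<Rightarrow> bool" where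
  "affine_functional_on F L \<longleftrightarrow> (\<forall>\<mu>\<in>F. \<forall>\<nu>\<in>F. \<forall>p\<in>{0..1}.
     L (mix_measure p \<mu> \<nu>) = p * L \<mu> + (1 - p) * L \<nu>)"

definition supported_on_at_most :: "nat \<Rightarrow> 'a measure \<Rightarrow> bool" where
  "supported_on_at_most k \<mu> \<longleftrightarrow>
     (\<exists>S. S \<subseteq> space \<mu> \<and> finite S \<and> card S \<le> k \<and> (AE x in \<mu>. x \<in> S))"

end

theory Submission
  imports Defs
begin

text \<open>
  By Helly's selection theorem the moment set is sequentially compact, so among the maximizers of
  \<open>L\<close> on it one can choose \<open>\<mu>\<close> with the largest moment of order \<open>m + 1\<close>. Let \<open>p \<noteq> 0\<close> be a polynomial
  in \<open>b - t\<close> of degree at most \<open>m + 1\<close> that is orthogonal in \<open>L\<^sup>2(\<mu>)\<close> to the powers of order at most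
  \<open>m\<close>. For small \<open>\<delta> > 0\<close> the measures \<open>(1 \<plusminus> \<delta> p) \<mu>\<close> lie in the moment set and have midpoint \<open>\<mu>\<close>, so
  by affinity both maximize \<open>L\<close>; the choice of \<open>\<mu>\<close> then makes \<open>p\<close> orthogonal to the power of order
  \<open>m + 1\<close> as well. Hence \<open>p\<close> is orthogonal to itself, and \<open>\<mu>\<close> lives on its roots.
  This replaces the Bauer maximum principle and the description of extreme points.
\<close>

section \<open>Linear algebra: homogeneous systems with more unknowns than equations\<close>

text \<open>Gaussian elimination, one equation per induction step: an equation with a nonzero
  coefficient is solved for that unknown, which leaves one equation and one unknown fewer.\<close>

lemma underdetermined_system_nontrivial_solution:
  fixes A :: "'j \<Rightarrow> 'i \<Rightarrow> 'k :: field"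
  assumes "finite J" "finite I" "card J < card I"
  shows "\<exists>x. (\<exists>i\<in>I. x i \<noteq> 0) \<and> (\<forall>j\<in>J. (\<Sum>i\<in>I. A j i * x i) = 0)"
  using assms
proof (induction J arbitrary: I A rule: finite_induct)
  case empty
  then obtain i where "i \<in> I"
    by (metis card.empty card_gt_0_iff ex_in_conv)
  then show ?case
    by (intro exI[of _ "\<lambda>_. 1"]) auto
next
  case (insert l J)
  show ?case
  proof (cases "\<forall>i\<in>I. A l i = 0")
    case True
    have "card J < card I"
      using insert by simp
    with insert.IH[OF insert.prems(1)] obtain x
      where "\<exists>i\<in>I. x i \<noteq> 0" "\<forall>j\<in>J. (\<Sum>i\<in>I. A j i * x i) = 0" by blast
    then show ?thesis using True by (intro exI[of _ x]) auto
  next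
    case False
    then obtain k where k: "k \<in> I" "A l k \<noteq> 0" by blast
    have "card J < card (I - {k})"
      using insert k by simp
    \<comment> \<open>Subtracting \<open>A j k / A l k\<close> times equation \<open>l\<close> from
      equation \<open>j\<close> removes the unknown \<open>k\<close> from it.\<close>
    with insert.IH[of "I - {k}" "\<lambda>j i. A j i - A j k * A l i / A l k"] insert.prems(1)
    obtain x where x: "\<exists>i\<in>I - {k}. x i \<noteq> 0"
      "\<And>j. j \<in> J \<Longrightarrow> (\<Sum>i\<in>I - {k}. (A j i - A j k * A l i / A l k) * x i) = 0" by auto
    define s where "s = (\<Sum>i\<in>I - {k}. A l i * x i)"
    \<comment> \<open>Back substitution: this value of the unknown \<open>k\<close> is the one that
      satisfies equation \<open>l\<close>.\<close>
    define y where "y = x(k := - s / A l k)"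
    have y: "(\<Sum>i\<in>I. A j i * y i) = (\<Sum>i\<in>I - {k}. A j i * x i) - A j k * s / A l k" for j
    proof -
      have "(\<Sum>i\<in>I - {k}. A j i * y i) = (\<Sum>i\<in>I - {k}. A j i * x i)"
        by (rule sum.cong) (auto simp: y_def)
      then show ?thesis
        using insert.prems(1) k by (simp add: sum.remove[of I k] y_def)
    qed
    have "(\<Sum>i\<in>I. A j i * y i) = 0" if "j \<in> insert l J" for j
    proof (cases "j = l")
      case True
      then show ?thesis using k by (simp add: y s_def)
    next
      case False
      then have "(\<Sum>i\<in>I - {k}. A j i * x i - A j k / A l k * (A l i * x i)) = 0"
        using x(2)[of j] that by (simp add: algebra_simps)
      then show ?thesis
        unfolding sum_subtractf sum_distrib_left[symmetric] s_def[symmetric] y by simp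
    qed
    moreover have "\<exists>i\<in>I. y i \<noteq> 0"
      using x(1) by (auto simp: y_def)
    ultimately show ?thesis by blast
  qed
qed

section \<open>Semicontinuity and maximization on sequentially compact sets\<close>

lemma upper_semicontinuous_on_uminus:
  "upper_semicontinuous_on X S (\<lambda>x. - f x) \<longleftrightarrow> lower_semicontinuous_on X S f"
proof -
  have eq: "- f x < r \<longleftrightarrow> - r < f x" for x r by linarith
  have all: "(\<forall>r :: real. P (- r)) \<longleftrightarrow> (\<forall>r. P r)" for P by (metis minus_minus)
  show ?thesis
    unfolding upper_semicontinuous_on_def lower_semicontinuous_on_def eq
    by (rule all)
qed

text \<open>If \<open>f x < r\<close>, the sublevel set of \<open>r\<close> would be a relative
  neighbourhood of \<open>x\<close>, hence would eventually contain the sequence. So superlevel sets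
  are closed under limits of sequences.\<close>

lemma upper_semicontinuous_on_limit_ge:
  assumes usc: "upper_semicontinuous_on X S f"
    and lim: "limitin X \<sigma> x sequentially" and "x \<in> S" "\<And>n. \<sigma> n \<in> S"
    and ge: "eventually (\<lambda>n. r \<le> f (\<sigma> n)) sequentially"
  shows "r \<le> f x"
proof (rule ccontr)
  assume "\<not> r \<le> f x"
  moreover have "limitin (subtopology X S) \<sigma> x sequentially"
    using assms by (simp add: limitin_subtopology)
  moreover have "openin (subtopology X S) {y \<in> topspace (subtopology X S). f y < r}"
    using usc by (simp add: upper_semicontinuous_on_def)
  ultimately have "eventually (\<lambda>n. f (\<sigma> n) < r) sequentially"
    using limitin_topspace[of "subtopology X S" \<sigma> x]
    by (fastforce simp: limitin_def elim!: eventually_mono)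
  with ge have "eventually (\<lambda>n. False) sequentially"
    by eventually_elim simp
  then show False by simp
qed

text \<open>The sequential form is chosen because Helly's theorem supplies convergent
  subsequences.\<close>

definition seq_compactin :: "'a topology \<Rightarrow> 'a set \<Rightarrow> bool" where
  "seq_compactin X S \<longleftrightarrow>
     (\<forall>\<sigma>. (\<forall>n. \<sigma> n \<in> S) \<longrightarrow> (\<exists>r x. strict_mono (r :: nat \<Rightarrow> nat) \<and> x \<in> S \<and> limitin X (\<sigma> \<circ> r) x sequentially))"

lemma seq_compactinE:
  assumes "seq_compactin X S" "\<And>n. \<sigma> n \<in> S"
  obtains r x where "strict_mono (r :: nat \<Rightarrow> nat)" "x \<in> S" "limitin X (\<sigma> \<circ> r) x sequentially"
  using assms unfolding seq_compactin_def by metis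

text \<open>The direct method: the value at a subsequential limit of a maximizing sequence dominates
  every term of that sequence, and therefore the supremum.\<close>

lemma upper_semicontinuous_on_attains_max:
  assumes "seq_compactin X S" "upper_semicontinuous_on X S f" "S \<noteq> {}"
  shows "\<exists>x\<in>S. \<forall>y\<in>S. f y \<le> f x"
proof -
  \<comment> \<open>The supremum is taken in \<open>ereal\<close> since \<open>f\<close> is not yet
    known to be bounded above.\<close>
  have "(\<lambda>x. ereal (f x)) ` S \<noteq> {}" using assms by simp
  from Sup_countable_SUP[OF this] obtain g where g: "incseq g"
    "range g \<subseteq> (\<lambda>x. ereal (f x)) ` S" "(SUP x\<in>S. ereal (f x)) = (SUP n. g n)" by metis
  then have "\<forall>n. \<exists>x\<in>S. g n = ereal (f x)" by blast
  then obtain \<sigma> where \<sigma>: "\<And>n. \<sigma> n \<in> S" "\<And>n. g n = ereal (f (\<sigma> n))" by metis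
  obtain r x where r: "strict_mono (r :: nat \<Rightarrow> nat)" "x \<in> S" "limitin X (\<sigma> \<circ> r) x sequentially"
    using seq_compactinE[OF assms(1), of \<sigma>] \<sigma>(1) by metis
  have "f (\<sigma> N) \<le> f x" for N
  proof (rule upper_semicontinuous_on_limit_ge[OF assms(2) r(3) r(2)])
    \<comment> \<open>The values increase along the maximizing sequence, and
      \<open>r n \<ge> n \<ge> N\<close>.\<close>
    have "f (\<sigma> N) \<le> f (\<sigma> (r n))" if "n \<ge> N" for n
      using incseqD[OF g(1), of N "r n"] \<sigma>(2) seq_suble[OF r(1), of n] that by simp
    then show "\<forall>\<^sub>F n in sequentially. f (\<sigma> N) \<le> f ((\<sigma> \<circ> r) n)"
      by (auto intro: eventually_sequentiallyI)
  qed (use \<sigma> in simp)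
  then have "(SUP n. g n) \<le> ereal (f x)"
    by (auto simp: \<sigma>(2) intro: SUP_least)
  then have "\<forall>y\<in>S. ereal (f y) \<le> ereal (f x)"
    unfolding g(3)[symmetric] by (simp add: SUP_le_iff)
  then show ?thesis using r(2) by auto
qed

lemma upper_semicontinuous_on_subset:
  assumes "upper_semicontinuous_on X S f" "T \<subseteq> S"
  shows "upper_semicontinuous_on X T f"
proof -
  have T: "subtopology X T = subtopology (subtopology X S) T"
    using assms(2) by (simp add: subtopology_subtopology Int_absorb1)
  have "{x \<in> topspace (subtopology X T). f x < r}
      = T \<inter> {x \<in> topspace (subtopology X S). f x < r}" for r
    using assms(2) by auto
  then show ?thesis
    using assms(1) unfolding upper_semicontinuous_on_def T
    by (metis openin_subtopology_Int2)
qed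

text \<open>The maximizers of \<open>f\<close> form a superlevel set, which inherits sequential
  compactness; \<open>g\<close> is then maximized on it.\<close>

lemma upper_semicontinuous_on_attains_lexicographic_max:
  assumes S: "seq_compactin X S" "S \<noteq> {}"
    and f: "upper_semicontinuous_on X S f" and g: "upper_semicontinuous_on X S g"
  shows "\<exists>x\<in>S. (\<forall>y\<in>S. f y \<le> f x) \<and> (\<forall>y\<in>S. f y = f x \<longrightarrow> g y \<le> g x)"
proof -
  obtain z where z: "z \<in> S" "\<forall>y\<in>S. f y \<le> f z"
    using upper_semicontinuous_on_attains_max[OF S(1) f S(2)] by blast
  \<comment> \<open>As \<open>f z\<close> is the maximum, these are exactly the maximizers; the
    inequality is the form that passes to limits.\<close>
  define T where "T = {y\<in>S. f z \<le> f y}"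
  have "seq_compactin X T"
    unfolding seq_compactin_def
  proof (intro allI impI)
    fix \<sigma> :: "nat \<Rightarrow> 'a" assume \<sigma>: "\<forall>n. \<sigma> n \<in> T"
    obtain r x where r: "strict_mono (r :: nat \<Rightarrow> nat)" "x \<in> S" "limitin X (\<sigma> \<circ> r) x sequentially"
      using seq_compactinE[OF S(1), of \<sigma>] \<sigma> unfolding T_def by blast
    have "f z \<le> f x"
      using \<sigma> by (intro upper_semicontinuous_on_limit_ge[OF f r(3) r(2)]) (auto simp: T_def)
    with r show "\<exists>r x. strict_mono (r :: nat \<Rightarrow> nat) \<and> x \<in> T \<and> limitin X (\<sigma> \<circ> r) x sequentially"
      by (auto simp: T_def)
  qed
  moreover have "upper_semicontinuous_on X T g"
    using g by (rule upper_semicontinuous_on_subset) (auto simp: T_def)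
  moreover have "T \<noteq> {}" using z by (auto simp: T_def)
  ultimately obtain x where "x \<in> T" "\<forall>y\<in>T. g y \<le> g x"
    using upper_semicontinuous_on_attains_max by blast
  then show ?thesis
    using z by (intro bexI[of _ x]) (auto simp: T_def intro: order_antisym order_trans)
qed

section \<open>Integrals of continuous functions and weak convergence on a compact interval\<close>

lemma borel_probs_space:
  assumes "\<mu> \<in> borel_probs a b"
  shows "space \<mu> = {a..b}"
  using assms sets_eq_imp_space_eq[of \<mu> "restrict_space borel {a..b}"]
  by (simp add: borel_probs_def space_restrict_space)

lemma continuous_on_measurable_borel_probs:
  fixes f :: "real \<Rightarrow> real"
  assumes "\<mu> \<in> borel_probs a b" "continuous_on {a..b} f"
  shows "f \<in> borel_measurable \<mu>"
  using borel_measurable_continuous_on_restrict[OF assms(2)] assms(1)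
  by (subst measurable_cong_sets[of \<mu> "restrict_space borel {a..b}" borel borel])
    (auto simp: borel_probs_def)

lemma continuous_on_Icc_bounded:
  fixes f :: "real \<Rightarrow> real"
  assumes "continuous_on {a..b} f"
  obtains C where "C > 0" "\<And>x. x \<in> {a..b} \<Longrightarrow> \<bar>f x\<bar> \<le> C"
proof -
  have "bounded (f ` {a..b})"
    using assms compact_continuous_image compact_imp_bounded by blast
  then show ?thesis
    using that by (auto simp: bounded_pos)
qed

lemma continuous_on_integrable_borel_probs:
  fixes f :: "real \<Rightarrow> real"
  assumes "\<mu> \<in> borel_probs a b" "continuous_on {a..b} f"
  shows "integrable \<mu> f"
proof -
  interpret prob_space \<mu> using assms by (simp add: borel_probs_def)
  obtain C where "C > 0" "\<And>x. x \<in> {a..b} \<Longrightarrow> \<bar>f x\<bar> \<le> C"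
    using continuous_on_Icc_bounded[OF assms(2)] by blast
  then show ?thesis
    using continuous_on_measurable_borel_probs[OF assms] borel_probs_space[OF assms(1)]
    by (intro integrable_const_bound[of _ C] AE_I2) auto
qed

text \<open>Eventual membership survives finite intersections and arbitrary unions, so by induction
  on the generation of open sets only the generating sets matter, and there it is convergence of one
  integral.\<close>

lemma limitin_weak_topologyI:
  assumes \<sigma>: "\<And>n. \<sigma> n \<in> borel_probs a b" and \<nu>: "\<nu> \<in> borel_probs a b"
    and conv: "\<And>f :: real \<Rightarrow> real. continuous_on {a..b} f \<Longrightarrow>
      (\<lambda>n. \<integral>x. f x \<partial>\<sigma> n) \<longlonglongrightarrow> (\<integral>x. f x \<partial>\<nu>)"
  shows "limitin (weak_topology a b) \<sigma> \<nu> sequentially"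
  unfolding limitin_def
proof (intro conjI allI impI)
  show "\<nu> \<in> topspace (weak_topology a b)" using \<nu> by simp
  fix U assume "openin (weak_topology a b) U \<and> \<nu> \<in> U"
  then have "generate_topology_on {{\<mu> \<in> borel_probs a b. (\<integral>x. f x \<partial>\<mu>) \<in> U} | (f :: real \<Rightarrow> real) U.
        continuous_on {a..b} f \<and> open U} U" "\<nu> \<in> U"
    by (auto simp: weak_topology_def openin_topology_generated_by_iff)
  then show "\<forall>\<^sub>F n in sequentially. \<sigma> n \<in> U"
  proof induction
    case (Int U V)
    then show ?case by (auto intro: eventually_conj)
  next
    case (UN K)
    then obtain V where V: "V \<in> K" "\<nu> \<in> V" by blast
    from UN.IH[OF this] show ?case
      using V(1) by (auto elim: eventually_mono)
  next
    case (Basis V)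
    then obtain f :: "real \<Rightarrow> real" and W where W: "continuous_on {a..b} f" "open W"
      "V = {\<mu> \<in> borel_probs a b. (\<integral>x. f x \<partial>\<mu>) \<in> W}" by blast
    have "(\<integral>x. f x \<partial>\<nu>) \<in> W"
      using \<open>\<nu> \<in> V\<close> W(3) by simp
    from topological_tendstoD[OF conv[OF W(1)] W(2) this] show ?case
      using \<sigma> W(3) by simp
  qed simp
qed

text \<open>Each sublevel set is cut out by a generating open set, with a half-line as target. This
  makes the moment of order \<open>m + 1\<close> usable as the secondary objective.\<close>

lemma upper_semicontinuous_on_integral:
  fixes f :: "real \<Rightarrow> real"
  assumes "continuous_on {a..b} f"
  shows "upper_semicontinuous_on (weak_topology a b) S (\<lambda>\<mu>. \<integral>x. f x \<partial>\<mu>)"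
  unfolding upper_semicontinuous_on_def
proof
  fix r :: real
  have "openin (weak_topology a b) {\<mu> \<in> borel_probs a b. (\<integral>x. f x \<partial>\<mu>) \<in> {..<r}}"
    unfolding weak_topology_def using assms
    by (intro topology_generated_by_Basis CollectI exI[of _ f] exI[of _ "{..<r}"]) simp
  from openin_subtopology_Int2[OF this]
  have "openin (subtopology (weak_topology a b) S)
      (S \<inter> {\<mu> \<in> borel_probs a b. (\<integral>x. f x \<partial>\<mu>) \<in> {..<r}})" .
  also have "S \<inter> {\<mu> \<in> borel_probs a b. (\<integral>x. f x \<partial>\<mu>) \<in> {..<r}}
      = {\<mu> \<in> topspace (subtopology (weak_topology a b) S). (\<integral>x. f x \<partial>\<mu>) < r}" by auto
  finally show "openin (subtopology (weak_topology a b) S) \<dots>" .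
qed

text \<open>
  Helly's theorem is stated for distributions on the whole line. The limit distribution is brought
  back to \<open>{a..b}\<close> by clamping, which does not change the integral of \<open>f (clamp x)\<close>.
\<close>

lemma borel_probs_convergent_subsequence:
  assumes "a \<le> b" and \<sigma>: "\<And>n. \<sigma> n \<in> borel_probs a b"
  shows "\<exists>r \<nu>. strict_mono (r :: nat \<Rightarrow> nat) \<and> \<nu> \<in> borel_probs a b \<and>
    (\<forall>f :: real \<Rightarrow> real. continuous_on {a..b} f \<longrightarrow>
      (\<lambda>n. \<integral>x. f x \<partial>\<sigma> (r n)) \<longlonglongrightarrow> (\<integral>x. f x \<partial>\<nu>))"
proof -
  let ?B = "restrict_space borel {a..b} :: real measure"
  define clamp where "clamp x = max a (min b x)" for x
  have clamp: "clamp x \<in> {a..b}" for x using assms(1) by (auto simp: clamp_def)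
  have clamp_id: "clamp x = x" if "x \<in> {a..b}" for x using that by (auto simp: clamp_def)
  have clamp_cont: "continuous_on UNIV clamp"
    unfolding clamp_def by (intro continuous_intros)
  have id_meas: "(\<lambda>x. x) \<in> measurable (\<sigma> n) borel" for n
    using \<sigma> by (intro continuous_on_measurable_borel_probs continuous_intros) auto
  define M where "M n = distr (\<sigma> n) borel (\<lambda>x. x)" for n
  have M: "real_distribution (M n)" for n
    using \<sigma>[of n] prob_space.prob_space_distr[OF _ id_meas]
    by (auto simp: real_distribution_def real_distribution_axioms_def M_def borel_probs_def)
  \<comment> \<open>Tightness is phrased with half-open intervals. Starting at \<open>a - 1\<close>
    keeps the point \<open>a\<close> inside and the interval nondegenerate even if
    \<open>a = b\<close>; this one interval serves all \<open>n\<close>.\<close>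
  have "measure (M n) {a - 1<..b} = 1" for n
  proof -
    interpret prob_space "\<sigma> n" using \<sigma> by (simp add: borel_probs_def)
    have "{a - 1<..b} \<inter> space (\<sigma> n) = space (\<sigma> n)"
      using borel_probs_space[OF \<sigma>] by auto
    then show ?thesis by (simp add: M_def measure_distr[OF id_meas] prob_space)
  qed
  then have "tight M"
    unfolding tight_def using M assms(1)
    by (intro conjI allI impI exI[of _ "a - 1"] exI[of _ b]) auto
  from tight_imp_convergent_subsubsequence[OF this strict_mono_id]
  obtain r N where r: "strict_mono (r :: nat \<Rightarrow> nat)" "real_distribution N" "weak_conv_m (M \<circ> r) N"
    by auto
  interpret N: real_distribution N by (rule r(2))
  have clamp_meas: "clamp \<in> measurable N ?B"
    using clamp borel_measurable_continuous_onI[OF clamp_cont]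
    by (intro measurable_restrict_space2) auto
  define \<nu> where "\<nu> = distr N ?B clamp"
  have "\<nu> \<in> borel_probs a b"
    using N.prob_space_distr[OF clamp_meas] by (simp add: \<nu>_def borel_probs_def)
  moreover have "(\<lambda>n. \<integral>x. f x \<partial>\<sigma> (r n)) \<longlonglongrightarrow> (\<integral>x. f x \<partial>\<nu>)"
    if f: "continuous_on {a..b} f" for f :: "real \<Rightarrow> real"
  proof -
    obtain C where C: "\<And>x. x \<in> {a..b} \<Longrightarrow> \<bar>f x\<bar> \<le> C"
      using continuous_on_Icc_bounded[OF f] by blast
    have fc: "continuous_on UNIV (\<lambda>x. f (clamp x))"
      using clamp by (intro continuous_on_compose2[OF f clamp_cont]) auto
    have "(\<lambda>n. \<integral>x. f (clamp x) \<partial>(M \<circ> r) n) \<longlonglongrightarrow> (\<integral>x. f (clamp x) \<partial>N)"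
    proof (rule weak_conv_imp_integral_bdd_continuous_conv[OF _ r(2,3)])
      show "real_distribution ((M \<circ> r) n)" for n using M by simp
      show "isCont (\<lambda>x. f (clamp x)) x" for x
        using fc by (simp add: continuous_on_eq_continuous_at)
      show "norm (f (clamp x)) \<le> C" for x using C clamp by simp
    qed
    moreover have "(\<integral>x. f (clamp x) \<partial>(M \<circ> r) n) = (\<integral>x. f x \<partial>\<sigma> (r n))" for n
    proof -
      have "(\<integral>x. f (clamp x) \<partial>(M \<circ> r) n) = (\<integral>x. f (clamp x) \<partial>\<sigma> (r n))"
        unfolding M_def comp_def
        by (rule integral_distr[OF id_meas borel_measurable_continuous_onI[OF fc]])
      also have "\<dots> = (\<integral>x. f x \<partial>\<sigma> (r n))"
        by (rule Bochner_Integration.integral_cong) (auto simp: borel_probs_space[OF \<sigma>] clamp_id)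
      finally show ?thesis .
    qed
    moreover have "(\<integral>x. f x \<partial>\<nu>) = (\<integral>x. f (clamp x) \<partial>N)"
      unfolding \<nu>_def
      by (rule integral_distr[OF clamp_meas borel_measurable_continuous_on_restrict[OF f]])
    ultimately show ?thesis by simp
  qed
  ultimately show ?thesis using r(1) by blast
qed

section \<open>Compactness of the moment set\<close>

lemma moment_set_alt:
  "\<mu> \<in> moment_set a b m c \<longleftrightarrow> \<mu> \<in> borel_probs a b \<and>
     (\<forall>j\<in>{1..m}. (\<integral>t. (b - t) ^ j \<partial>\<mu>) = fact j * c j)"
  by (auto simp: moment_set_def field_simps)

lemma affine_functional_on_uminus:
  assumes "affine_functional_on F L"
  shows "affine_functional_on F (\<lambda>\<mu>. - L \<mu>)"
  unfolding affine_functional_on_def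
proof (intro ballI)
  fix \<mu> \<nu> and p :: real
  assume "\<mu> \<in> F" "\<nu> \<in> F" "p \<in> {0..1}"
  with assms have "L (mix_measure p \<mu> \<nu>) = p * L \<mu> + (1 - p) * L \<nu>"
    unfolding affine_functional_on_def by blast
  then show "- L (mix_measure p \<mu> \<nu>) = p * - L \<mu> + (1 - p) * - L \<nu>"
    by simp
qed

text \<open>The constraints are integrals of continuous functions, so they pass to the limit of the
  subsequence given by Helly's theorem.\<close>

lemma seq_compactin_moment_set:
  assumes "a \<le> b"
  shows "seq_compactin (weak_topology a b) (moment_set a b m c)"
  unfolding seq_compactin_def
proof (intro allI impI)
  fix \<sigma> :: "nat \<Rightarrow> real measure" assume \<sigma>: "\<forall>n. \<sigma> n \<in> moment_set a b m c"
  then have bp: "\<And>n. \<sigma> n \<in> borel_probs a b" by (simp add: moment_set_alt)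
  from borel_probs_convergent_subsequence[of a b \<sigma>, OF assms this]
  obtain r \<nu> where r: "strict_mono (r :: nat \<Rightarrow> nat)" "\<nu> \<in> borel_probs a b"
    and all_conv: "\<forall>f :: real \<Rightarrow> real. continuous_on {a..b} f \<longrightarrow>
      (\<lambda>n. \<integral>x. f x \<partial>\<sigma> (r n)) \<longlonglongrightarrow> (\<integral>x. f x \<partial>\<nu>)" by (elim exE conjE)
  note conv = all_conv[rule_format]
  have "(\<integral>t. (b - t) ^ j \<partial>\<nu>) = fact j * c j" if "j \<in> {1..m}" for j
  proof (rule LIMSEQ_unique)
    show "(\<lambda>n. \<integral>t. (b - t) ^ j \<partial>\<sigma> (r n)) \<longlonglongrightarrow> (\<integral>t. (b - t) ^ j \<partial>\<nu>)"
      by (intro conv continuous_intros)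
    show "(\<lambda>n. \<integral>t. (b - t) ^ j \<partial>\<sigma> (r n)) \<longlonglongrightarrow> fact j * c j"
      using \<sigma> that by (simp add: moment_set_alt)
  qed
  moreover have "limitin (weak_topology a b) (\<sigma> \<circ> r) \<nu> sequentially"
    using bp r(2) conv by (intro limitin_weak_topologyI) auto
  ultimately show "\<exists>r x. strict_mono (r :: nat \<Rightarrow> nat) \<and> x \<in> moment_set a b m c \<and>
      limitin (weak_topology a b) (\<sigma> \<circ> r) x sequentially"
    using r by (intro exI[of _ r] exI[of _ \<nu>]) (simp add: moment_set_alt)
qed

section \<open>Orthogonal polynomials and perturbation of a measure by a density\<close>

text \<open>Orthogonality to the powers \<open>0, ..., m\<close> gives \<open>m + 1\<close> linear
  equations for \<open>m + 2\<close> coefficients; their matrix is the Hankel matrix of the moments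
  of \<open>\<mu>\<close>.\<close>

lemma orthogonal_polynomial_exists:
  assumes \<mu>: "\<mu> \<in> borel_probs a b"
  obtains \<alpha> :: "nat \<Rightarrow> real" where "\<exists>i\<le>m + 1. \<alpha> i \<noteq> 0"
    "\<And>j. j \<le> m \<Longrightarrow> (\<integral>t. (b - t) ^ j * (\<Sum>i\<le>m + 1. \<alpha> i * (b - t) ^ i) \<partial>\<mu>) = 0"
proof -
  obtain \<alpha> :: "nat \<Rightarrow> real" where \<alpha>: "\<exists>i\<in>{..m + 1}. \<alpha> i \<noteq> 0"
    "\<forall>j\<in>{..m}. (\<Sum>i\<in>{..m + 1}. (\<integral>t. (b - t) ^ (j + i) \<partial>\<mu>) * \<alpha> i) = 0"
    using underdetermined_system_nontrivial_solution[of "{..m}" "{..m + 1}"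
        "\<lambda>j i. \<integral>t. (b - t) ^ (j + i) \<partial>\<mu>"] by auto
  have eq: "(\<integral>t. (b - t) ^ j * (\<Sum>i\<le>m + 1. \<alpha> i * (b - t) ^ i) \<partial>\<mu>)
      = (\<Sum>i\<le>m + 1. (\<integral>t. (b - t) ^ (j + i) \<partial>\<mu>) * \<alpha> i)" for j
  proof -
    have int: "integrable \<mu> (\<lambda>t. (b - t) ^ (j + i) * \<alpha> i)" for i
      by (intro continuous_on_integrable_borel_probs[OF \<mu>] continuous_intros)
    have "(\<integral>t. (b - t) ^ j * (\<Sum>i\<le>m + 1. \<alpha> i * (b - t) ^ i) \<partial>\<mu>)
        = (\<integral>t. (\<Sum>i\<le>m + 1. (b - t) ^ (j + i) * \<alpha> i) \<partial>\<mu>)"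
      by (simp only: sum_distrib_left power_add mult_ac)
    also have "\<dots> = (\<Sum>i\<le>m + 1. (\<integral>t. (b - t) ^ (j + i) * \<alpha> i \<partial>\<mu>))"
      using int by (rule Bochner_Integration.integral_sum)
    finally show ?thesis by simp
  qed
  show ?thesis
    by (rule that[of \<alpha>], use \<alpha>(1) in blast, unfold eq, use \<alpha>(2) in blast)
qed

text \<open>The bound on \<open>h\<close> makes the density nonnegative, so that
  \<open>ennreal\<close> truncates nothing, and the vanishing mean of \<open>h\<close> keeps the
  total mass at 1.\<close>

lemma density_perturbation:
  fixes h :: "real \<Rightarrow> real"
  assumes \<mu>: "\<mu> \<in> borel_probs a b" and h: "continuous_on {a..b} h"
    and le: "\<And>t. t \<in> {a..b} \<Longrightarrow> \<bar>h t\<bar> \<le> 1" and mean: "(\<integral>t. h t \<partial>\<mu>) = 0"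
  defines "\<nu> \<equiv> density \<mu> (\<lambda>t. ennreal (1 + h t))"
  shows density_perturbation_in_borel_probs: "\<nu> \<in> borel_probs a b"
    and integral_density_perturbation: "\<And>f :: real \<Rightarrow> real. continuous_on {a..b} f \<Longrightarrow>
      (\<integral>t. f t \<partial>\<nu>) = (\<integral>t. f t \<partial>\<mu>) + (\<integral>t. f t * h t \<partial>\<mu>)"
proof -
  interpret \<mu>: prob_space \<mu> using \<mu> by (simp add: borel_probs_def)
  note int = continuous_on_integrable_borel_probs[OF \<mu>]
  note meas = continuous_on_measurable_borel_probs[OF \<mu>]
  have nonneg: "AE t in \<mu>. 0 \<le> 1 + h t"
    using le borel_probs_space[OF \<mu>] by (intro AE_I2) (fastforce dest: abs_le_D2)
  have "emeasure \<nu> (space \<nu>) = (\<integral>\<^sup>+t. ennreal (1 + h t) \<partial>\<mu>)"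
    using meas[OF h] by (simp add: \<nu>_def emeasure_density cong: nn_integral_cong)
  also have "\<dots> = ennreal (\<integral>t. 1 + h t \<partial>\<mu>)"
    using nonneg int[OF h] by (intro nn_integral_eq_integral) auto
  also have "\<dots> = 1"
    using int[OF h] mean by (simp add: \<mu>.prob_space)
  finally have "prob_space \<nu>" by (rule prob_spaceI)
  then show "\<nu> \<in> borel_probs a b"
    using \<mu> by (simp add: borel_probs_def \<nu>_def)
  show "(\<integral>t. f t \<partial>\<nu>) = (\<integral>t. f t \<partial>\<mu>) + (\<integral>t. f t * h t \<partial>\<mu>)"
    if f: "continuous_on {a..b} f" for f :: "real \<Rightarrow> real"
  proof -
    have "(\<integral>t. f t \<partial>\<nu>) = (\<integral>t. (1 + h t) * f t \<partial>\<mu>)"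
      unfolding \<nu>_def using meas[OF h] meas[OF f] nonneg
      by (subst integral_density) auto
    also have "\<dots> = (\<integral>t. f t + f t * h t \<partial>\<mu>)"
      by (simp add: algebra_simps)
    also have "\<dots> = (\<integral>t. f t \<partial>\<mu>) + (\<integral>t. f t * h t \<partial>\<mu>)"
      using f h by (intro Bochner_Integration.integral_add int continuous_intros)
    finally show ?thesis .
  qed
qed

text \<open>The two densities are nonnegative and average to 1 pointwise. The form
  \<open>1 + - h t\<close> matches the perturbation lemmas instantiated with the negated
  function.\<close>

lemma mix_measure_opposite_perturbations:
  fixes h :: "real \<Rightarrow> real"
  assumes h: "h \<in> borel_measurable \<mu>" and le: "\<And>t. t \<in> space \<mu> \<Longrightarrow> \<bar>h t\<bar> \<le> 1"
  shows "mix_measure (1/2) (density \<mu> (\<lambda>t. ennreal (1 + h t)))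
    (density \<mu> (\<lambda>t. ennreal (1 + - h t))) = \<mu>"
proof (rule measure_eqI)
  fix A assume "A \<in> sets (mix_measure (1/2) (density \<mu> (\<lambda>t. ennreal (1 + h t)))
    (density \<mu> (\<lambda>t. ennreal (1 + - h t))))"
  then have A: "A \<in> sets \<mu>" by simp
  have eq: "ennreal (1/2) * ennreal (1 + h t) + ennreal (1/2) * ennreal (1 + - h t) = 1"
    if "t \<in> space \<mu>" for t
  proof -
    have nonneg: "0 \<le> 1 + h t" "0 \<le> 1 + - h t" using le[OF that] by auto
    have "ennreal (1/2) * ennreal (1 + h t) + ennreal (1/2) * ennreal (1 + - h t)
        = ennreal (1/2 * (1 + h t) + 1/2 * (1 + - h t))"
      using nonneg by (subst ennreal_plus) (simp_all only: ennreal_mult, simp_all)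
    also have "1/2 * (1 + h t) + 1/2 * (1 + - h t) = 1" by (simp add: field_simps)
    finally show ?thesis by simp
  qed
  have "emeasure (mix_measure (1/2) (density \<mu> (\<lambda>t. ennreal (1 + h t)))
      (density \<mu> (\<lambda>t. ennreal (1 + - h t)))) A
    = ennreal (1/2) * (\<integral>\<^sup>+t. ennreal (1 + h t) * indicator A t \<partial>\<mu>)
      + ennreal (1/2) * (\<integral>\<^sup>+t. ennreal (1 + - h t) * indicator A t \<partial>\<mu>)"
    using A h by (subst emeasure_mix_measure) (simp_all add: emeasure_density)
  also have "\<dots> = (\<integral>\<^sup>+t. ennreal (1/2) * (ennreal (1 + h t) * indicator A t)
      + ennreal (1/2) * (ennreal (1 + - h t) * indicator A t) \<partial>\<mu>)"
    using A h by (simp add: nn_integral_add nn_integral_cmult)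
  also have "\<dots> = (\<integral>\<^sup>+t. indicator A t \<partial>\<mu>)"
  proof (rule nn_integral_cong)
    fix t assume "t \<in> space \<mu>"
    from eq[OF this] show "ennreal (1/2) * (ennreal (1 + h t) * indicator A t)
      + ennreal (1/2) * (ennreal (1 + - h t) * indicator A t) = indicator A t"
      by (simp add: indicator_def)
  qed
  finally show "emeasure (mix_measure (1/2) (density \<mu> (\<lambda>t. ennreal (1 + h t)))
      (density \<mu> (\<lambda>t. ennreal (1 + - h t)))) A = emeasure \<mu> A"
    using A by simp
qed simp

text \<open>Orthogonality for \<open>j = 0\<close> preserves the mass, and for
  \<open>j = 1, ..., m\<close> the prescribed moments.\<close>

lemma density_perturbation_in_moment_set:
  fixes h :: "real \<Rightarrow> real"
  assumes \<mu>: "\<mu> \<in> moment_set a b m c" and h: "continuous_on {a..b} h"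
    and le: "\<And>t. t \<in> {a..b} \<Longrightarrow> \<bar>h t\<bar> \<le> 1"
    and orth: "\<And>j. j \<le> m \<Longrightarrow> (\<integral>t. (b - t) ^ j * h t \<partial>\<mu>) = 0"
  shows "density \<mu> (\<lambda>t. ennreal (1 + h t)) \<in> moment_set a b m c"
proof -
  have bp: "\<mu> \<in> borel_probs a b" using \<mu> by (simp add: moment_set_alt)
  have mean: "(\<integral>t. h t \<partial>\<mu>) = 0" using orth[of 0] by simp
  have "continuous_on {a..b} (\<lambda>t. (b - t) ^ j)" for j
    by (intro continuous_intros)
  then show ?thesis
    using \<mu> density_perturbation_in_borel_probs[OF bp h le mean]
      integral_density_perturbation[OF bp h le mean] orth
    by (simp add: moment_set_alt)
qed

section \<open>Existence of optimizers with finite support\<close>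

text \<open>A nonzero polynomial of degree at most \<open>n\<close> has at most \<open>n\<close>
  roots, and \<open>z = b - t\<close> carries the support points to roots.\<close>

lemma supported_on_at_most_polynomial_roots:
  fixes \<alpha> :: "nat \<Rightarrow> real"
  assumes \<mu>: "\<mu> \<in> borel_probs a b" and "\<exists>i\<le>n. \<alpha> i \<noteq> 0"
    and "AE t in \<mu>. (\<Sum>i\<le>n. \<alpha> i * (b - t) ^ i) = 0"
  shows "supported_on_at_most n \<mu>"
proof -
  define Z where "Z = {z. (\<Sum>i\<le>n. \<alpha> i * z ^ i) = 0}"
  have Z: "finite Z" "card Z \<le> n"
    using polyfun_rootbound[where c = \<alpha>] assms(2) unfolding Z_def by auto
  define S where "S = {t \<in> space \<mu>. b - t \<in> Z}"
  have S: "S \<subseteq> (\<lambda>z. b - z) ` Z"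
    unfolding S_def by (auto intro!: image_eqI[of _ _ "b - _"])
  have "finite S" "card S \<le> n"
    using S Z finite_subset[OF S] card_mono[OF _ S] card_image_le[of Z "\<lambda>z. b - z"] by auto
  moreover have "AE t in \<mu>. t \<in> S"
    using assms(3) AE_space by eventually_elim (simp add: S_def Z_def)
  ultimately show ?thesis
    unfolding supported_on_at_most_def by (intro exI[of _ S]) (auto simp: S_def)
qed

text \<open>Applied to \<open>L\<close> and to its negative, this yields both halves of
  \<open>theorem4\<close>.\<close>

lemma attains_max_supported_on_at_most:
  assumes "a \<le> b" and ne: "moment_set a b m c \<noteq> {}"
    and aff: "affine_functional_on (moment_set a b m c) L"
    and usc: "upper_semicontinuous_on (weak_topology a b) (moment_set a b m c) L"
  shows "\<exists>\<mu>\<in>moment_set a b m c. supported_on_at_most (m + 1) \<mu> \<and>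
    (\<forall>\<nu>\<in>moment_set a b m c. L \<nu> \<le> L \<mu>)"
proof -
  have cont: "continuous_on {a..b} (\<lambda>t. (b - t) ^ j)" for j
    by (intro continuous_intros)
  obtain \<mu> where \<mu>: "\<mu> \<in> moment_set a b m c"
    and max: "\<forall>\<nu>\<in>moment_set a b m c. L \<nu> \<le> L \<mu>"
    and max2: "\<forall>\<nu>\<in>moment_set a b m c. L \<nu> = L \<mu> \<longrightarrow>
      (\<integral>t. (b - t) ^ (m + 1) \<partial>\<nu>) \<le> (\<integral>t. (b - t) ^ (m + 1) \<partial>\<mu>)"
    using upper_semicontinuous_on_attains_lexicographic_max[OF
        seq_compactin_moment_set[OF assms(1)] ne usc upper_semicontinuous_on_integral[OF cont]]
    by blast
  have bp: "\<mu> \<in> borel_probs a b" using \<mu> by (simp add: moment_set_alt)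
  obtain \<alpha> :: "nat \<Rightarrow> real" where \<alpha>: "\<exists>i\<le>m + 1. \<alpha> i \<noteq> 0"
    "\<And>j. j \<le> m \<Longrightarrow> (\<integral>t. (b - t) ^ j * (\<Sum>i\<le>m + 1. \<alpha> i * (b - t) ^ i) \<partial>\<mu>) = 0"
    using orthogonal_polynomial_exists[OF bp] by blast
  define p where "p t = (\<Sum>i\<le>m + 1. \<alpha> i * (b - t) ^ i)" for t
  have p: "continuous_on {a..b} p"
    unfolding p_def by (intro continuous_intros)
  obtain C where C: "C > 0" "\<And>t. t \<in> {a..b} \<Longrightarrow> \<bar>p t\<bar> \<le> C"
    using continuous_on_Icc_bounded[OF p] by blast
  \<comment> \<open>Here \<open>1 / C\<close> is the small factor \<open>\<delta>\<close>: it brings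
    the perturbation below 1 in absolute value on the interval.\<close>
  define h where "h t = p t / C" for t
  have h: "continuous_on {a..b} h" "continuous_on {a..b} (\<lambda>t. - h t)"
    unfolding h_def using C(1) by (auto intro!: continuous_intros p)
  have h_le: "\<bar>h t\<bar> \<le> 1" "\<bar>- h t\<bar> \<le> 1" if "t \<in> {a..b}" for t
    using C that by (auto simp: h_def abs_divide)
  have orth: "(\<integral>t. (b - t) ^ j * h t \<partial>\<mu>) = 0" "(\<integral>t. (b - t) ^ j * - h t \<partial>\<mu>) = 0" if "j \<le> m" for j
    using \<alpha>(2)[OF that] by (simp_all add: h_def p_def[abs_def])
  have mean: "(\<integral>t. h t \<partial>\<mu>) = 0" "(\<integral>t. - h t \<partial>\<mu>) = 0"
    using orth[of 0] by simp_all
  let ?\<nu>1 = "density \<mu> (\<lambda>t. ennreal (1 + h t))" and ?\<nu>2 = "density \<mu> (\<lambda>t. ennreal (1 + - h t))"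
  note \<nu>1 = density_perturbation_in_moment_set[OF \<mu> h(1) h_le(1) orth(1)]
  note \<nu>2 = density_perturbation_in_moment_set[OF \<mu> h(2) h_le(2) orth(2)]
  have "L \<mu> = 1/2 * L ?\<nu>1 + (1 - 1/2) * L ?\<nu>2"
    using bspec[OF bspec[OF bspec[OF aff[unfolded affine_functional_on_def] \<nu>1] \<nu>2], of "1/2"]
      mix_measure_opposite_perturbations[OF continuous_on_measurable_borel_probs[OF bp h(1)]]
      h_le(1) borel_probs_space[OF bp] by simp
  moreover have "L ?\<nu>1 \<le> L \<mu>" "L ?\<nu>2 \<le> L \<mu>"
    using max \<nu>1 \<nu>2 by auto
  \<comment> \<open>Two numbers not exceeding \<open>L \<mu>\<close> whose average is
    \<open>L \<mu>\<close> both equal it.\<close>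
  ultimately have "L ?\<nu>1 = L \<mu>" "L ?\<nu>2 = L \<mu>" by (auto simp: field_simps)
  then have "(\<integral>t. (b - t) ^ (m + 1) \<partial>?\<nu>1) \<le> (\<integral>t. (b - t) ^ (m + 1) \<partial>\<mu>)"
    "(\<integral>t. (b - t) ^ (m + 1) \<partial>?\<nu>2) \<le> (\<integral>t. (b - t) ^ (m + 1) \<partial>\<mu>)"
    using max2 \<nu>1 \<nu>2 by blast+
  moreover have "(\<integral>t. (b - t) ^ (m + 1) \<partial>?\<nu>1)
      = (\<integral>t. (b - t) ^ (m + 1) \<partial>\<mu>) + (\<integral>t. (b - t) ^ (m + 1) * h t \<partial>\<mu>)"
    by (rule integral_density_perturbation[OF bp h(1) h_le(1) mean(1) cont])
  moreover have "(\<integral>t. (b - t) ^ (m + 1) \<partial>?\<nu>2)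
      = (\<integral>t. (b - t) ^ (m + 1) \<partial>\<mu>) + (\<integral>t. (b - t) ^ (m + 1) * - h t \<partial>\<mu>)"
    by (rule integral_density_perturbation[OF bp h(2) h_le(2) mean(2) cont])
  moreover have "(\<integral>t. (b - t) ^ (m + 1) * - h t \<partial>\<mu>)
      = - (\<integral>t. (b - t) ^ (m + 1) * h t \<partial>\<mu>)"
    by (simp only: mult_minus_right Bochner_Integration.integral_minus)
  \<comment> \<open>The perturbation by \<open>h\<close> bounds this integral above by 0, the
    opposite one bounds it below by 0.\<close>
  ultimately have "(\<integral>t. (b - t) ^ (m + 1) * h t \<partial>\<mu>) = 0" by linarith
  then have "(\<integral>t. (b - t) ^ (m + 1) * p t \<partial>\<mu>) = 0"
    using C(1) by (simp add: h_def)
  with \<alpha>(2) have zero: "(\<integral>t. (b - t) ^ i * p t \<partial>\<mu>) = 0" if "i \<le> m + 1" for i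
    using that by (cases "i = m + 1") (auto simp: p_def[abs_def])
  \<comment> \<open>Expanding only one factor \<open>p\<close> into powers reduces the square to the
    integrals in \<open>zero\<close>.\<close>
  have "(\<integral>t. p t * p t \<partial>\<mu>) = (\<integral>t. (\<Sum>i\<le>m + 1. \<alpha> i * ((b - t) ^ i * p t)) \<partial>\<mu>)"
    by (simp only: p_def[of "_"] sum_distrib_right mult_ac)
  also have "\<dots> = (\<Sum>i\<le>m + 1. (\<integral>t. \<alpha> i * ((b - t) ^ i * p t) \<partial>\<mu>))"
    by (intro Bochner_Integration.integral_sum continuous_on_integrable_borel_probs[OF bp]
        continuous_intros p)
  also have "\<dots> = 0"
    using zero by simp
  finally have "AE t in \<mu>. p t * p t = 0"
    by (subst (asm) integral_nonneg_eq_0_iff_AE)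
      (auto intro!: continuous_on_integrable_borel_probs[OF bp] continuous_intros p)
  then have "supported_on_at_most (m + 1) \<mu>"
    using supported_on_at_most_polynomial_roots[OF bp \<alpha>(1)] by (simp add: p_def)
  with \<mu> max show ?thesis by blast
qed

theorem theorem4:
  fixes a b :: real and m :: nat and c :: "nat \<Rightarrow> real" and L :: "real measure \<Rightarrow> real"
  assumes "a < b"
    and "m \<ge> 1"
    and "\<exists>\<epsilon>. admissible a b \<epsilon> \<and> (\<forall>j\<in>{1..m}. c j = \<epsilon> j)"
    and "affine_functional_on (moment_set a b m c) L"
  shows "(upper_semicontinuous_on (weak_topology a b) (moment_set a b m c) L \<longrightarrow>
           (\<exists>\<mu>\<in>moment_set a b m c. supported_on_at_most (m + 1) \<mu> \<and>
              ereal (L \<mu>) = (SUP \<nu>\<in>moment_set a b m c. ereal (L \<nu>))))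
       \<and> (lower_semicontinuous_on (weak_topology a b) (moment_set a b m c) L \<longrightarrow>
           (\<exists>\<mu>\<in>moment_set a b m c. supported_on_at_most (m + 1) \<mu> \<and>
              ereal (L \<mu>) = (INF \<nu>\<in>moment_set a b m c. ereal (L \<nu>))))"
proof -
  \<comment> \<open>The measure that represents the admissible sequence is a member.\<close>
  have "moment_set a b m c \<noteq> {}"
    using assms(3) by (auto simp: admissible_def moment_set_def)
  note attains = attains_max_supported_on_at_most[OF less_imp_le[OF assms(1)] this]
  show ?thesis
  proof (intro conjI impI)
    assume "upper_semicontinuous_on (weak_topology a b) (moment_set a b m c) L"
    from attains[OF assms(4) this] obtain \<mu> where "\<mu> \<in> moment_set a b m c"
      "supported_on_at_most (m + 1) \<mu>" "\<forall>\<nu>\<in>moment_set a b m c. L \<nu> \<le> L \<mu>" by blast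
    then show "\<exists>\<mu>\<in>moment_set a b m c. supported_on_at_most (m + 1) \<mu> \<and>
        ereal (L \<mu>) = (SUP \<nu>\<in>moment_set a b m c. ereal (L \<nu>))"
      by (intro bexI[of _ \<mu>] conjI antisym SUP_upper SUP_least) auto
  next
    assume "lower_semicontinuous_on (weak_topology a b) (moment_set a b m c) L"
    then have "upper_semicontinuous_on (weak_topology a b) (moment_set a b m c) (\<lambda>\<mu>. - L \<mu>)"
      by (simp add: upper_semicontinuous_on_uminus)
    from attains[OF affine_functional_on_uminus[OF assms(4)] this] obtain \<mu> where "\<mu> \<in> moment_set a b m c"
      "supported_on_at_most (m + 1) \<mu>" "\<forall>\<nu>\<in>moment_set a b m c. L \<mu> \<le> L \<nu>"
      by auto
    then show "\<exists>\<mu>\<in>moment_set a b m c. supported_on_at_most (m + 1) \<mu> \<and>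
        ereal (L \<mu>) = (INF \<nu>\<in>moment_set a b m c. ereal (L \<nu>))"
      by (intro bexI[of _ \<mu>] conjI antisym INF_lower INF_greatest) auto
  qed
qed

end
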